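(* Let $R=\mathbb{K}[x_1,\ldots,x_n]$, where $\mathbb{K}$ is a field of prime characteristic $p>0$, let $\mathfrak{m}=(x_1,\ldots,x_n)$, and let $\mathfrak{a}_\bullet,\mathfrak{b}_\bullet$ be nontrivial monomial filtrations in $R$. Let $\mathfrak{d}_\bullet=\{\mathfrak{a}_i\cap\mathfrak{b}_i\}_{i\ge 0}$. Then, for each choice of sign $\pm$ (the same throughout), $$\mathcal{C}_{\pm}^{\mathfrak{m}}(\mathfrak{d}_\bullet)=\min\{\mathcal{C}_{\pm}^{\mathfrak{m}}(\mathfrak{a}_\bullet),\mathcal{C}_{\pm}^{\mathfrak{m}}(\mathfrak{b}_\bullet)\}.$$
   Context: A filtration of ideals in $R$ is a sequence $\mathfrak{a}_\bullet=\{\mathfrak{a}_i\}_{i\ge 0}$ of ideals with $\mathfrak{a}_0=R$, $\mathfrak{a}_{i+1}\subseteq\mathfrak{a}_i$, and $\mathfrak{a}_i\mathfrak{a}_j\subseteq \mathfrak{a}_{i+j}$ for all $i,j\ge 0$; it is a monomial filtration if every $\mathfrak{a}_i$, $i\ge1$, is a monomial ideal, and nontrivial if $\mathfrak{a}_1$ is a non-zero proper ideal. $\mathfrak{m}^{[p^e]}=(x_1^{p^e},\ldots,x_n^{p^e})$. For $e\ge 0$ put $\nu_{\mathfrak{a}_\bullet}^{\mathfrak{m}}(p^e)=\sup\{r\in\mathbb{Z}_{\ge 0}:\mathfrak{a}_r\not\subseteq \mathfrak{m}^{[p^e]}\}\in\mathbb{Z}_{\ge 0}\cup\{\infty\}$,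 $\mathcal{C}_+^{\mathfrak{m}}(\mathfrak{a}_\bullet)=\limsup_{e\to\infty}\nu_{\mathfrak{a}_\bullet}^{\mathfrak{m}}(p^e)/p^e$ and $\mathcal{C}_-^{\mathfrak{m}}(\mathfrak{a}_\bullet)=\liminf_{e\to\infty}\nu_{\mathfrak{a}_\bullet}^{\mathfrak{m}}(p^e)/p^e$, in $[0,\infty]$. *)

theory Defs
  imports
    "HOL-Library.Poly_Mapping"
    "HOL-Library.Extended_Nat"
    "HOL-Library.Extended_Nonnegative_Real"
    "HOL-Computational_Algebra.Computational_Algebra"
begin

(* The polynomial ring over 'k whose variables are the elements of 'v. For 'v of class finite
   this is K[x_1, ..., x_n] with n = CARD('v) >= 1; a monomial is its exponent vector. *)
type_synonym ('v, 'k) mpoly = "('v \<Rightarrow>\<^sub>0 nat) \<Rightarrow>\<^sub>0 'k"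

definition monom_of :: "('v \<Rightarrow>\<^sub>0 nat) \<Rightarrow> ('v, 'k::zero_neq_one) mpoly" where
  "monom_of s = Poly_Mapping.single s 1"

definition var :: "'v \<Rightarrow> ('v, 'k::zero_neq_one) mpoly" where
  "var i = monom_of (Poly_Mapping.single i 1)"

(* A commutative ring as a module over itself: ideal.subspace I says that I is an ideal,
   and ideal.span B is the ideal generated by B. *)
interpretation ideal: module "(*) :: 'a::comm_ring_1 \<Rightarrow> 'a \<Rightarrow> 'a"
  by standard (simp_all add: algebra_simps)

definition ideal_prod :: "'a::comm_ring_1 set \<Rightarrow> 'a set \<Rightarrow> 'a set" where
  "ideal_prod I J = ideal.span {f * g | f g. f \<in> I \<and> g \<in> J}"

definition monomial_ideal :: "('v, 'k::comm_ring_1) mpoly set \<Rightarrow> bool" where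
  "monomial_ideal I \<longleftrightarrow> (\<exists>S. I = ideal.span (monom_of ` S))"

definition filtration :: "(nat \<Rightarrow> 'a::comm_ring_1 set) \<Rightarrow> bool" where
  "filtration a \<longleftrightarrow>
     (\<forall>i. ideal.subspace (a i)) \<and>
     a 0 = UNIV \<and>
     (\<forall>i. a (Suc i) \<subseteq> a i) \<and>
     (\<forall>i j. ideal_prod (a i) (a j) \<subseteq> a (i + j))"

definition monomial_filtration :: "(nat \<Rightarrow> ('v, 'k::comm_ring_1) mpoly set) \<Rightarrow> bool" where
  "monomial_filtration a \<longleftrightarrow> filtration a \<and> (\<forall>i\<ge>1. monomial_ideal (a i))"

definition nontrivial :: "(nat \<Rightarrow> 'a::comm_ring_1 set) \<Rightarrow> bool" where
  "nontrivial a \<longleftrightarrow> a 1 \<noteq> {0} \<and> a 1 \<noteq> UNIV"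

(* The bracket power of the ideal m generated by all variables: generated by the x_i ^ q. *)
definition m_bracket :: "nat \<Rightarrow> ('v, 'k::comm_ring_1) mpoly set" where
  "m_bracket q = ideal.span (range (\<lambda>i. var i ^ q))"

definition nu :: "(nat \<Rightarrow> ('v, 'k::comm_ring_1) mpoly set) \<Rightarrow> nat \<Rightarrow> enat" where
  "nu a q = Sup {enat r | r. \<not> a r \<subseteq> m_bracket q}"

definition C_plus :: "nat \<Rightarrow> (nat \<Rightarrow> ('v, 'k::comm_ring_1) mpoly set) \<Rightarrow> ennreal" where
  "C_plus p a = limsup (\<lambda>e. ennreal_of_enat (nu a (p ^ e)) / of_nat (p ^ e))"

definition C_minus :: "nat \<Rightarrow> (nat \<Rightarrow> ('v, 'k::comm_ring_1) mpoly set) \<Rightarrow> ennreal" where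
  "C_minus p a = liminf (\<lambda>e. ennreal_of_enat (nu a (p ^ e)) / of_nat (p ^ e))"

end

theory Submission
  imports Defs
begin

text \<open>
  A monomial ideal lies outside \<open>m\<^sup>[\<^sup>q\<^sup>]\<close> iff it contains the socle monomial
  \<open>u\<^sub>q = (x\<^sub>1 \<dots> x\<^sub>n)\<^sup>q\<^sup>-\<^sup>1\<close>. Hence \<open>\<nu>(q)\<close> is the supremum of the initial segment
  \<open>{r. u\<^sub>q \<in> a\<^sub>r}\<close> of the naturals; initial segments form a chain, so
  \<open>\<nu>\<^sub>d(q) = min (\<nu>\<^sub>a(q)) (\<nu>\<^sub>b(q))\<close> holds exactly. Since \<open>u\<^sub>q\<^sup>p\<close> divides \<open>u\<^sub>p\<^sub>q\<close>, also
  \<open>p \<cdot> \<nu>(q) \<le> \<nu>(p q)\<close>, so \<open>\<nu>(p\<^sup>e) / p\<^sup>e\<close> is increasing in \<open>e\<close>. The upper and lower limits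
  are therefore limits, and limits commute with \<open>min\<close>.
\<close>

section \<open>Monomials, exponent vectors and divisibility\<close>

lemma monom_of_mult:
  "(monom_of (s + t) :: ('v, 'k::comm_ring_1) mpoly) = monom_of s * monom_of t"
  by (simp add: monom_of_def mult_single)

lemma monom_of_0: "(monom_of 0 :: ('v, 'k::comm_ring_1) mpoly) = 1"
  by (simp add: monom_of_def)

lemma var_power:
  "(var i ^ q :: ('v, 'k::comm_ring_1) mpoly) = monom_of (Poly_Mapping.single i q)"
proof (induction q)
  case 0
  then show ?case by (simp add: monom_of_0)
next
  case (Suc q)
  have "Poly_Mapping.single i (Suc q) = Poly_Mapping.single i 1 + Poly_Mapping.single i q"
    by (simp flip: single_add)
  with Suc show ?case by (simp add: var_def monom_of_mult)
qed

text \<open>Finiteness of \<open>'v\<close> gives every exponent function finite support, so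
  \<open>Abs_poly_mapping\<close> preserves the constant one.\<close>

definition const_exp :: "nat \<Rightarrow> ('v::finite \<Rightarrow>\<^sub>0 nat)" where
  "const_exp k = Abs_poly_mapping (\<lambda>_. k)"

lemma lookup_const_exp [simp]: "Poly_Mapping.lookup (const_exp k) i = k"
  by (simp add: const_exp_def)

text \<open>Over a field and for \<open>q > 0\<close>, its class spans the socle of the quotient by
  \<open>m_bracket q\<close>. Truncated subtraction gives 1 at \<open>q = 0\<close>, where
  \<open>m_bracket 0\<close> is the whole ring; hence the hypotheses \<open>q > 0\<close>
  below.\<close>

definition socle_monom :: "nat \<Rightarrow> ('v::finite, 'k::comm_ring_1) mpoly" where
  "socle_monom q = monom_of (const_exp (q - 1))"

text \<open>Pointwise comparison of exponents is divisibility, with cofactor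
  \<open>monom_of (t - s)\<close>, and ideals absorb multiples.\<close>

lemma monom_of_mem_ideal_mono:
  fixes I :: "('v, 'k::comm_ring_1) mpoly set"
  assumes "ideal.subspace I" "monom_of s \<in> I"
    and "\<And>i. Poly_Mapping.lookup s i \<le> Poly_Mapping.lookup t i"
  shows "monom_of t \<in> I"
proof -
  have "t = (t - s) + s"
    by (rule poly_mapping_eqI) (simp add: lookup_add lookup_minus assms(3))
  then have "(monom_of t :: ('v, 'k) mpoly) = monom_of (t - s) * monom_of s"
    by (metis monom_of_mult)
  with assms show ?thesis by (metis ideal.subspace_scale)
qed

section \<open>Monomial ideals against bracket powers\<close>

lemma exponent_ge_if_mem_m_bracket:
  fixes f :: "('v, 'k::comm_ring_1) mpoly"
  assumes "f \<in> m_bracket q" "t \<in> Poly_Mapping.keys f"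
  shows "\<exists>i. q \<le> Poly_Mapping.lookup t i"
proof -
  \<comment> \<open>The polynomials with the claimed property form an ideal containing the
    generators \<open>var i ^ q\<close>, hence containing their span.\<close>
  define J where "J = {f :: ('v, 'k) mpoly. \<forall>t\<in>Poly_Mapping.keys f. \<exists>i. q \<le> Poly_Mapping.lookup t i}"
  have "ideal.subspace J"
  proof (rule ideal.subspaceI)
    show "0 \<in> J" by (simp add: J_def)
  next
    fix x y assume "x \<in> J" "y \<in> J"
    then show "x + y \<in> J" using keys_add[of x y] by (auto simp: J_def)
  next
    fix c x assume "x \<in> J"
    then show "c * x \<in> J" using keys_mult[of c x]
      by (fastforce simp: J_def lookup_add intro: trans_le_add2)
  qed
  moreover have "range (\<lambda>i. var i ^ q) \<subseteq> J"
  proof -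
    have "\<exists>j. q \<le> Poly_Mapping.lookup (Poly_Mapping.single i q) j" for i :: 'v
      by (rule exI[of _ i]) simp
    then show ?thesis by (auto simp: J_def var_power monom_of_def)
  qed
  ultimately have "m_bracket q \<subseteq> J"
    unfolding m_bracket_def by (intro ideal.span_minimal)
  with assms show ?thesis by (auto simp: J_def)
qed

lemma monom_of_mem_m_bracket:
  assumes "q \<le> Poly_Mapping.lookup s i"
  shows "(monom_of s :: ('v, 'k::comm_ring_1) mpoly) \<in> m_bracket q"
proof (rule monom_of_mem_ideal_mono)
  show "ideal.subspace (m_bracket q :: ('v, 'k) mpoly set)"
    unfolding m_bracket_def by simp
  show "(monom_of (Poly_Mapping.single i q) :: ('v, 'k) mpoly) \<in> m_bracket q"
    unfolding m_bracket_def var_power[symmetric] by (intro ideal.span_base) simp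
  show "Poly_Mapping.lookup (Poly_Mapping.single i q) j \<le> Poly_Mapping.lookup s j" for j
    using assms by (auto simp: lookup_single when_def)
qed

lemma socle_monom_notin_m_bracket:
  assumes "q > 0"
  shows "(socle_monom q :: ('v::finite, 'k::comm_ring_1) mpoly) \<notin> m_bracket q"
proof
  assume "(socle_monom q :: ('v, 'k) mpoly) \<in> m_bracket q"
  moreover have "(const_exp (q - 1) :: 'v \<Rightarrow>\<^sub>0 nat) \<in> Poly_Mapping.keys (socle_monom q :: ('v, 'k) mpoly)"
    by (simp add: socle_monom_def monom_of_def)
  ultimately obtain i where "q \<le> Poly_Mapping.lookup (const_exp (q - 1) :: 'v \<Rightarrow>\<^sub>0 nat) i"
    using exponent_ge_if_mem_m_bracket by blast
  with assms show False by simp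
qed

text \<open>A monomial generator outside \<open>m_bracket q\<close> has all exponents at most
  \<open>q - 1\<close>, so it divides \<open>socle_monom q\<close> and forces the latter into
  \<open>I\<close>.\<close>

lemma monomial_ideal_subset_m_bracket_iff:
  fixes I :: "('v::finite, 'k::comm_ring_1) mpoly set"
  assumes "monomial_ideal I" "q > 0"
  shows "I \<subseteq> m_bracket q \<longleftrightarrow> socle_monom q \<notin> I"
proof
  assume "I \<subseteq> m_bracket q"
  then show "socle_monom q \<notin> I"
    using socle_monom_notin_m_bracket[OF assms(2)] by (metis subsetD)
next
  assume notin: "socle_monom q \<notin> I"
  obtain S where S: "I = ideal.span (monom_of ` S)"
    using assms(1) unfolding monomial_ideal_def by (elim exE)
  have "monom_of s \<in> (m_bracket q :: ('v, 'k) mpoly set)" if "s \<in> S" for s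
  proof (rule ccontr)
    assume "monom_of s \<notin> (m_bracket q :: ('v, 'k) mpoly set)"
    then have lt: "Poly_Mapping.lookup s i < q" for i
      using monom_of_mem_m_bracket[of q s i, where 'k = 'k] by (metis not_le)
    have "Poly_Mapping.lookup s i \<le> Poly_Mapping.lookup (const_exp (q - 1)) i" for i
      unfolding lookup_const_exp using lt[of i] by linarith
    moreover have "monom_of s \<in> I"
      unfolding S using that by (intro ideal.span_base imageI)
    moreover have "ideal.subspace I"
      unfolding S by (rule ideal.subspace_span)
    ultimately have "socle_monom q \<in> I"
      unfolding socle_monom_def by (metis monom_of_mem_ideal_mono)
    with notin show False by (rule notE)
  qed
  then show "I \<subseteq> m_bracket q"
    unfolding S by (intro ideal.span_minimal) (auto simp: m_bracket_def)
qed

section \<open>Filtrations and powers of the socle monomial\<close>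

lemma monomial_filtration_imp_monomial_ideal:
  fixes a :: "nat \<Rightarrow> ('v, 'k::comm_ring_1) mpoly set"
  assumes "monomial_filtration a"
  shows "monomial_ideal (a i)"
proof (cases "i = 0")
  case True
  \<comment> \<open>The definition covers only \<open>i \<ge> 1\<close>; the remaining ideal
    \<open>a 0 = UNIV\<close> is generated by the monomial 1.\<close>
  have "1 \<in> ideal.span (monom_of ` {0} :: ('v, 'k) mpoly set)"
    by (simp add: monom_of_0 ideal.span_base)
  then have "f \<in> ideal.span (monom_of ` {0})" for f :: "('v, 'k) mpoly"
    using ideal.span_scale[of 1 _ f] by simp
  then have "UNIV = ideal.span (monom_of ` {0} :: ('v, 'k) mpoly set)" by blast
  then have "monomial_ideal (UNIV :: ('v, 'k) mpoly set)"
    unfolding monomial_ideal_def by blast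
  with True assms show ?thesis
    by (simp add: monomial_filtration_def filtration_def)
next
  case False
  with assms show ?thesis by (simp add: monomial_filtration_def)
qed

lemma filtration_antimono:
  assumes "filtration a" "i \<le> j"
  shows "a j \<subseteq> a i"
proof -
  have "a (Suc n) \<subseteq> a n" for n using assms(1) by (simp add: filtration_def)
  then show ?thesis using assms(2) by (rule lift_Suc_antimono_le)
qed

lemma filtration_mult:
  assumes "filtration a" "f \<in> a i" "g \<in> a j"
  shows "f * g \<in> a (i + j)"
proof -
  have "f * g \<in> ideal_prod (a i) (a j)"
    unfolding ideal_prod_def using assms by (intro ideal.span_base) blast
  moreover have "ideal_prod (a i) (a j) \<subseteq> a (i + j)"
    using assms(1) by (simp add: filtration_def)
  ultimately show ?thesis by (rule subsetD[rotated])
qed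

lemma filtration_power:
  assumes "filtration a" "f \<in> a r"
  shows "f ^ k \<in> a (k * r)"
proof (induction k)
  case 0
  with assms show ?case by (simp add: filtration_def)
next
  case (Suc k)
  with filtration_mult[OF assms(1,2)] show ?case by simp
qed

lemma monom_of_power:
  "\<exists>t. (monom_of s :: ('v, 'k::comm_ring_1) mpoly) ^ k = monom_of t \<and>
    (\<forall>i. Poly_Mapping.lookup t i = k * Poly_Mapping.lookup s i)"
proof (induction k)
  case 0
  show ?case by (rule exI[of _ 0]) (simp add: monom_of_0)
next
  case (Suc k)
  then obtain t where "(monom_of s :: ('v, 'k) mpoly) ^ k = monom_of t"
    "\<forall>i. Poly_Mapping.lookup t i = k * Poly_Mapping.lookup s i"
    by blast
  then show ?case by (intro exI[of _ "s + t"]) (simp add: monom_of_mult lookup_add)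
qed

text \<open>The \<open>k\<close>-th power of \<open>socle_monom q\<close> lies in
  \<open>a (k * r)\<close> and divides \<open>socle_monom (k * q)\<close>, because
  \<open>k * (q - 1) \<le> k * q - 1\<close>.\<close>

lemma socle_monom_mem_mult:
  fixes a :: "nat \<Rightarrow> ('v::finite, 'k::comm_ring_1) mpoly set"
  assumes "filtration a" "socle_monom q \<in> a r" "k > 0"
  shows "socle_monom (k * q) \<in> a (k * r)"
proof -
  obtain t where t: "(socle_monom q :: ('v, 'k) mpoly) ^ k = monom_of t"
    "\<And>i. Poly_Mapping.lookup t i = k * (q - 1)"
    using monom_of_power[of "const_exp (q - 1)" k] unfolding socle_monom_def by auto
  have "monom_of t \<in> a (k * r)"
    using filtration_power[OF assms(1,2), of k] t(1) by simp
  moreover have "ideal.subspace (a (k * r))" using assms(1) by (simp add: filtration_def)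
  moreover have "Poly_Mapping.lookup t i \<le> Poly_Mapping.lookup (const_exp (k * q - 1)) i" for i
    using assms(3) by (simp add: t(2) diff_mult_distrib2 diff_le_mono2)
  ultimately show ?thesis
    unfolding socle_monom_def by (metis monom_of_mem_ideal_mono)
qed

section \<open>The invariant \<open>nu\<close> read off from the socle monomial\<close>

definition socle_indices :: "(nat \<Rightarrow> ('v::finite, 'k::comm_ring_1) mpoly set) \<Rightarrow> nat \<Rightarrow> nat set" where
  "socle_indices a q = {r. socle_monom q \<in> a r}"

lemma nu_eq_Sup_socle_indices:
  assumes "monomial_filtration a" "q > 0"
  shows "nu a q = Sup (enat ` socle_indices a q)"
  unfolding nu_def socle_indices_def
  using monomial_ideal_subset_m_bracket_iff[OF monomial_filtration_imp_monomial_ideal[OF assms(1)] assms(2)]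
  by (intro arg_cong[of _ _ Sup]) auto

text \<open>This avoids showing that \<open>a r \<inter> b r\<close> is monomial. If
  \<open>socle_monom q\<close> lies in both ideals, it witnesses non-containment; if it is missing
  from one, that ideal alone is already inside \<open>m_bracket q\<close>.\<close>

lemma nu_Int_eq_Sup_socle_indices:
  fixes a b :: "nat \<Rightarrow> ('v::finite, 'k::comm_ring_1) mpoly set"
  assumes "monomial_filtration a" "monomial_filtration b" "q > 0"
  shows "nu (\<lambda>i. a i \<inter> b i) q = Sup (enat ` (socle_indices a q \<inter> socle_indices b q))"
proof -
  have "\<not> a r \<inter> b r \<subseteq> m_bracket q \<longleftrightarrow> r \<in> socle_indices a q \<inter> socle_indices b q" for r
    using socle_monom_notin_m_bracket[OF assms(3), where ?'v = 'v and ?'k = 'k]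
      assms(1,2)[THEN monomial_filtration_imp_monomial_ideal, of r]
      monomial_ideal_subset_m_bracket_iff[OF _ assms(3)]
    unfolding socle_indices_def by blast
  then show ?thesis
    unfolding nu_def by (intro arg_cong[of _ _ Sup]) auto
qed

lemma socle_indices_down_closed:
  assumes "monomial_filtration a" "r \<in> socle_indices a q" "s \<le> r"
  shows "s \<in> socle_indices a q"
  using assms(2) filtration_antimono[of a s r] assms(1,3)
  unfolding socle_indices_def monomial_filtration_def by blast

lemma nu_Int:
  fixes a b :: "nat \<Rightarrow> ('v::finite, 'k::comm_ring_1) mpoly set"
  assumes "monomial_filtration a" "monomial_filtration b" "q > 0"
  shows "nu (\<lambda>i. a i \<inter> b i) q = min (nu a q) (nu b q)"
proof -
  have "socle_indices a q \<subseteq> socle_indices b q \<or> socle_indices b q \<subseteq> socle_indices a q"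
    using socle_indices_down_closed[OF assms(1)] socle_indices_down_closed[OF assms(2)]
    by (meson nat_le_linear subsetI)
  then show ?thesis
  proof
    assume "socle_indices a q \<subseteq> socle_indices b q"
    moreover from this have "nu a q \<le> nu b q"
      using assms by (auto simp: nu_eq_Sup_socle_indices intro!: Sup_subset_mono)
    ultimately show ?thesis
      using assms by (simp add: nu_eq_Sup_socle_indices nu_Int_eq_Sup_socle_indices Int_absorb2 min_absorb1)
  next
    assume "socle_indices b q \<subseteq> socle_indices a q"
    moreover from this have "nu b q \<le> nu a q"
      using assms by (auto simp: nu_eq_Sup_socle_indices intro!: Sup_subset_mono)
    ultimately show ?thesis
      using assms by (simp add: nu_eq_Sup_socle_indices nu_Int_eq_Sup_socle_indices Int_absorb1 min_absorb2)
  qed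
qed

text \<open>Each index \<open>r\<close> at level \<open>q\<close> yields the index
  \<open>k * r\<close> at level \<open>k * q\<close>. Working in \<open>ennreal\<close> treats
  infinite \<open>nu\<close> uniformly.\<close>

lemma mult_nu_le:
  fixes a :: "nat \<Rightarrow> ('v::finite, 'k::comm_ring_1) mpoly set"
  assumes "monomial_filtration a" "q > 0" "k > 0"
  shows "of_nat k * ennreal_of_enat (nu a q) \<le> ennreal_of_enat (nu a (k * q))"
proof -
  \<comment> \<open>Nonemptiness serves to carry the supremum from \<open>enat\<close> to
    \<open>ennreal\<close>; index 0 qualifies because \<open>a 0 = UNIV\<close>.\<close>
  have "socle_indices a q \<noteq> {}"
  proof -
    have "0 \<in> socle_indices a q"
      using assms(1) by (simp add: socle_indices_def monomial_filtration_def filtration_def)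
    then show ?thesis by blast
  qed
  then have "of_nat k * ennreal_of_enat (nu a q) = (SUP r\<in>socle_indices a q. of_nat (k * r))"
    using assms by (simp add: nu_eq_Sup_socle_indices ennreal_of_enat_Sup image_image SUP_mult_left_ennreal)
  also have "\<dots> \<le> ennreal_of_enat (nu a (k * q))"
  proof (rule SUP_least)
    fix r assume "r \<in> socle_indices a q"
    then have "k * r \<in> socle_indices a (k * q)"
      using assms socle_monom_mem_mult[of a q r k]
      by (simp add: socle_indices_def monomial_filtration_def)
    then have "enat (k * r) \<le> nu a (k * q)"
      using assms by (auto simp: nu_eq_Sup_socle_indices intro: Sup_upper)
    then have "ennreal_of_enat (enat (k * r)) \<le> ennreal_of_enat (nu a (k * q))"
      by (simp only: ennreal_of_enat_le_iff)
    then show "of_nat (k * r) \<le> ennreal_of_enat (nu a (k * q))" by simp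
  qed
  finally show ?thesis .
qed

section \<open>Monotone quotients and passage to the limit\<close>

lemma incseq_nu_quotient:
  fixes a :: "nat \<Rightarrow> ('v::finite, 'k::comm_ring_1) mpoly set"
  assumes "monomial_filtration a" "p > 0"
  shows "incseq (\<lambda>e. ennreal_of_enat (nu a (p ^ e)) / of_nat (p ^ e))"
proof (rule incseq_SucI)
  fix e
  have p: "(of_nat p :: ennreal) \<noteq> 0" "(of_nat p :: ennreal) \<noteq> top"
    using assms(2) by (auto simp: of_nat_eq_0_iff)
  \<comment> \<open>Expanding the fraction by \<open>p\<close>, legitimate in \<open>ennreal\<close>
    since \<open>p\<close> is nonzero and finite, prepares for \<open>mult_nu_le\<close> with
    \<open>k = p\<close>.\<close>
  have "ennreal_of_enat (nu a (p ^ e)) / of_nat (p ^ e)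
      = (of_nat p * ennreal_of_enat (nu a (p ^ e))) / (of_nat p * of_nat (p ^ e))"
    using p divide_mult_eq[of "of_nat p :: ennreal" "ennreal_of_enat (nu a (p ^ e))" "of_nat (p ^ e)"]
    by (metis infinity_ennreal_def mult.commute)
  also have "\<dots> \<le> ennreal_of_enat (nu a (p ^ Suc e)) / of_nat (p ^ Suc e)"
    using mult_nu_le[OF assms(1) _ assms(2), of "p ^ e"] assms(2)
    by (simp add: divide_right_mono_ennreal)
  finally show "ennreal_of_enat (nu a (p ^ e)) / of_nat (p ^ e)
      \<le> ennreal_of_enat (nu a (p ^ Suc e)) / of_nat (p ^ Suc e)" .
qed

theorem proposition4p9:
  fixes p :: nat
    and a b d :: "nat \<Rightarrow> ('v::finite, 'k::field) mpoly set"
  assumes "prime p" and "CHAR('k) = p"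
    and "monomial_filtration a" and "nontrivial a"
    and "monomial_filtration b" and "nontrivial b"
    and "d = (\<lambda>i. a i \<inter> b i)"
  shows "C_plus p d = min (C_plus p a) (C_plus p b) \<and>
         C_minus p d = min (C_minus p a) (C_minus p b)"
proof -
  have p: "p > 0" using assms(1) by (rule prime_gt_0_nat)
  define X where "X c e = ennreal_of_enat (nu c (p ^ e)) / of_nat (p ^ e)"
    for c :: "nat \<Rightarrow> ('v, 'k) mpoly set" and e
  \<comment> \<open>A genuine limit settles both signs at once.\<close>
  have lim_C: "C_plus p c = L \<and> C_minus p c = L" if "X c \<longlonglongrightarrow> L" for c L
    using lim_imp_Limsup[OF sequentially_bot that] lim_imp_Liminf[OF sequentially_bot that]
    by (simp add: C_plus_def C_minus_def X_def[abs_def])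
  have lim: "X c \<longlonglongrightarrow> (SUP e. X c e)" if "monomial_filtration c" for c
    using incseq_nu_quotient[OF that p] by (intro LIMSEQ_SUP) (simp add: X_def[abs_def])
  have "X d e = min (X a e) (X b e)" for e
  proof -
    \<comment> \<open>A monotone map between linear orders commutes with \<open>min\<close>, which
      transfers \<open>nu_Int\<close> to the quotients.\<close>
    have "mono (\<lambda>n. ennreal_of_enat n / of_nat (p ^ e))"
      by (intro monoI divide_right_mono_ennreal) (simp add: ennreal_of_enat_le_iff)
    from min_of_mono[OF this] show ?thesis
      using p nu_Int[OF assms(3,5), of "p ^ e"] by (simp add: X_def assms(7))
  qed
  then have "X d = (\<lambda>e. min (X a e) (X b e))" by (rule ext)
  \<comment> \<open>Convergence for \<open>d\<close> is inherited from \<open>a\<close> and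
    \<open>b\<close> by continuity of \<open>min\<close>, infinite limits included.\<close>
  with tendsto_min[OF lim[OF assms(3)] lim[OF assms(5)]]
  have "X d \<longlonglongrightarrow> min (SUP e. X a e) (SUP e. X b e)" by simp
  from lim_C[OF this] lim_C[OF lim[OF assms(3)]] lim_C[OF lim[OF assms(5)]]
  show ?thesis by simp
qed

end
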